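(* Let $J$ be an interval of the real line and let $\mu$ be a probability measure on the Borel $\sigma$-field of $J$. Let $(I_k)_{k>0}$ be a sequence of subintervals of $J$ and let $\delta\in(0,1]$ be a real number. The following two statements are equivalent: 1. $\mu(\limsup_kI_k)\ge\delta$. 2. There exists a sequence $(\Gamma_k)_{k>0}$ of intervals such that $\Gamma_k\subset I_k$ for every $k>0$, $\sum_{k>0}\mu(\Gamma_k)=\infty$ and $$\limsup_n\left\|\frac{\sum_{k=1}^n\mathbf 1_{\Gamma_k}}{\sum_{k=1}^n\mu(\Gamma_k)}\right\|_\infty\le\frac1\delta.$$
   Context: $\limsup_kI_k=\bigcap_N\bigcup_{k\ge N}I_k$. $\|\cdot\|_\infty$ is the essential supremum norm with respect to $\mu$. The empty set is regarded as an interval. The quotient is considered for $n$ large enough that its denominator is positive. *)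

theory Defs
  imports "HOL-Probability.Probability"
begin

text \<open>The index set of a sequence is \<open>{1..}\<close>; the value at index \<open>0\<close> is ignored.\<close>

definition limsup_sets :: "(nat \<Rightarrow> 'a set) \<Rightarrow> 'a set" where
  "limsup_sets A = (\<Inter>N\<in>{1..}. \<Union>k\<in>{N..}. A k)"

text \<open>Values are extended reals because \<open>esssup\<close> needs a complete linear order.\<close>

definition Linf_norm :: "'a measure \<Rightarrow> ('a \<Rightarrow> real) \<Rightarrow> ereal" where
  "Linf_norm M f = esssup M (\<lambda>x. ereal \<bar>f x\<bar>)"

end

theory Submission
  imports Defs "HOL-Real_Asymp.Real_Asymp"
begin

text \<open>
  (2) implies (1): the quotients have integral 1, are eventually at most \<open>1/r\<close> almost everywhere for
  any \<open>r < \<delta>\<close>, and tend to 0 off \<open>limsup \<Gamma>\<close>; by dominated convergence \<open>limsup \<Gamma>\<close> has measure at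
  least \<open>r\<close>.

  (1) implies (2): cut the index set into consecutive finite blocks, the \<open>j\<close>-th of which is long
  enough that its intervals cover measure at least \<open>\<delta> - 2\<^sup>-\<^sup>j\<close>. Inside a block, shrink the intervals to
  disjoint subintervals with the same union. Then each block adds at most 1 to the counting
  function and at least \<open>\<delta> - 2\<^sup>-\<^sup>j\<close> to the sum of the measures, so the quotient is at most
  \<open>(j + 1) / (\<delta> j - 2)\<close> within block \<open>j\<close>.
\<close>

section \<open>Divergent series and upper limits of sets\<close>

text \<open>Nonnegative terms make the partial sums monotone, so being unbounded, tending to
  infinity and having an infinite sum in \<open>ennreal\<close> coincide. The proofs can then work
  with the real sums over \<open>{1..n}\<close>, which are the denominators of the
  quotients.\<close>

lemma partial_sums_at_top_iff:
  fixes f :: "nat \<Rightarrow> real"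
  assumes nonneg: "\<And>k. 0 \<le> f k"
  shows "filterlim (\<lambda>n. \<Sum>k=1..n. f k) at_top sequentially \<longleftrightarrow>
    (\<Sum>k. ennreal (f (Suc k))) = \<infinity>"
proof -
  have reindex: "(\<Sum>k=1..n. f k) = (\<Sum>k<n. f (Suc k))" for n
    by (induction n) auto
  have mono: "(\<Sum>k=1..m. f k) \<le> (\<Sum>k=1..n. f k)" if "m \<le> n" for m n
    using that nonneg by (intro sum_mono2) auto
  show ?thesis
  proof
    assume lim: "filterlim (\<lambda>n. \<Sum>k=1..n. f k) at_top sequentially"
    show "(\<Sum>k. ennreal (f (Suc k))) = \<infinity>"
    proof (rule ccontr)
      assume "(\<Sum>k. ennreal (f (Suc k))) \<noteq> \<infinity>"
      then have "summable (\<lambda>k. f (Suc k))"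
        using nonneg by (intro summable_suminf_not_top) auto
      then have "(\<Sum>k=1..n. f k) \<le> (\<Sum>k. f (Suc k))" for n
        unfolding reindex using nonneg by (intro sum_le_suminf) auto
      moreover have "eventually (\<lambda>n. (\<Sum>k. f (Suc k)) < (\<Sum>k=1..n. f k)) sequentially"
        using lim by (simp add: filterlim_at_top_dense)
      ultimately show False
        by (metis (mono_tags, lifting) eventually_sequentially order_refl leD)
    qed
  next
    assume inf: "(\<Sum>k. ennreal (f (Suc k))) = \<infinity>"
    have "\<not> summable (\<lambda>k. f (Suc k))"
      using inf nonneg suminf_ennreal2[of "\<lambda>k. f (Suc k)"] by auto
    then have "\<exists>n. x < (\<Sum>k=1..n. f k)" for x
      using summableI_nonneg_bounded[of "\<lambda>k. f (Suc k)" x] nonneg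
      unfolding reindex by (meson not_less)
    then show "filterlim (\<lambda>n. \<Sum>k=1..n. f k) at_top sequentially"
      unfolding filterlim_at_top_dense eventually_sequentially
      by (meson mono less_le_trans)
  qed
qed

lemma sets_limsup_sets:
  assumes "\<And>k. k > 0 \<Longrightarrow> A k \<in> sets M"
  shows "limsup_sets A \<in> sets M"
  unfolding limsup_sets_def using assms
  by (intro sets.countable_INT' sets.countable_UN') auto

lemma limsup_sets_mono:
  assumes "\<And>k. k > 0 \<Longrightarrow> A k \<subseteq> B k"
  shows "limsup_sets A \<subseteq> limsup_sets B"
  unfolding limsup_sets_def
proof (intro INF_mono bexI)
  fix N :: nat assume "N \<in> {1..}"
  then show "(\<Union>k\<in>{N..}. A k) \<subseteq> (\<Union>k\<in>{N..}. B k)"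
    using assms by (intro UN_mono) auto
qed

section \<open>From bounded quotients to the measure of the upper limit\<close>

context prob_space
begin

lemma measure_limsup_sets_ge:
  fixes \<delta> :: real
  assumes events: "\<And>k. k > 0 \<Longrightarrow> A k \<in> events" and \<delta>: "0 < \<delta>"
    and lim: "filterlim (\<lambda>n. \<Sum>k=1..n. prob (A k)) at_top sequentially"
    and bound: "limsup (\<lambda>n. Linf_norm M
         (\<lambda>x. (\<Sum>k=1..n. indicator (A k) x) / (\<Sum>k=1..n. prob (A k)))) \<le> ereal (1 / \<delta>)"
  shows "\<delta> \<le> prob (limsup_sets A)"
proof (rule ccontr)
  define E where "E n = (\<Sum>k=1..n. prob (A k))" for n
  define f :: "nat \<Rightarrow> 'a \<Rightarrow> real" where "f n x = (\<Sum>k=1..n. indicator (A k) x) / E n" for n x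
  define L where "L = limsup_sets A"
  assume "\<not> \<delta> \<le> prob (limsup_sets A)"
  \<comment> \<open>A bound on the limsup passes to late terms only with some room:
    \<open>1 / r\<close> exceeds \<open>1 / \<delta>\<close>, so the norms are eventually below it,
    while \<open>r\<close> still exceeds \<open>prob L\<close>, which is what the end of the proof
    contradicts.\<close>
  then obtain r where r: "prob L < r" "r < \<delta>"
    using dense[of "prob L" \<delta>] by (auto simp: L_def)
  have r_pos: "0 < r"
    using r(1) measure_nonneg[of M L] by linarith
  have [measurable]: "L \<in> events"
    unfolding L_def using events by (rule sets_limsup_sets)
  have [measurable]: "f n \<in> borel_measurable M" for n
    unfolding f_def using events
    by (intro borel_measurable_divide borel_measurable_sum borel_measurable_indicator) auto
  have E_lim: "filterlim E at_top sequentially"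
    using lim unfolding E_def .
  have f_nonneg: "0 \<le> f n x" for n x
    by (simp add: f_def E_def sum_nonneg)
  have "1 / \<delta> < 1 / r"
    using r r_pos by (simp add: field_simps)
  then have "limsup (\<lambda>n. Linf_norm M (f n)) < ereal (1 / r)"
    using le_less_trans[OF bound] unfolding f_def E_def by simp
  then have "eventually (\<lambda>n. Linf_norm M (f n) < ereal (1 / r)) sequentially"
    by (rule Limsup_lessD)
  moreover have "eventually (\<lambda>n. 0 < E n) sequentially"
    using E_lim by (simp add: filterlim_at_top_dense)
  \<comment> \<open>Before \<open>n0\<close> the denominator may vanish; the quotient is then 0 by
    the convention for division and does not have integral 1.\<close>
  ultimately obtain n0 where n0: "\<And>n. n0 \<le> n \<Longrightarrow> Linf_norm M (f n) < ereal (1 / r)"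
      "\<And>n. n0 \<le> n \<Longrightarrow> 0 < E n"
    unfolding eventually_sequentially by (meson le_trans linear)
  have f_le: "AE x in M. f n x \<le> 1 / r" if "n0 \<le> n" for n
    using esssup_AE[of "\<lambda>x. ereal \<bar>f n x\<bar>" M]
  proof eventually_elim
    case (elim x)
    then have "ereal \<bar>f n x\<bar> < ereal (1 / r)"
      using n0(1)[OF that] unfolding Linf_norm_def by (rule le_less_trans)
    then show ?case by simp
  qed
  have f_int: "integrable M (f n)" if "n0 \<le> n" for n
    using f_le[OF that] f_nonneg by (intro integrable_const_bound[where B = "1 / r"]) auto
  have integral_f: "integral\<^sup>L M (f n) = 1" if "n0 \<le> n" for n
  proof -
    have "integral\<^sup>L M (f n) = (\<Sum>k=1..n. integral\<^sup>L M (indicator (A k))) / E n"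
      unfolding f_def using events
      by (subst integral_divide_zero, subst Bochner_Integration.integral_sum)
         (auto intro!: integrable_real_indicator simp: less_top[symmetric])
    also have "(\<Sum>k=1..n. integral\<^sup>L M (indicator (A k) :: 'a \<Rightarrow> real)) = E n"
      unfolding E_def using events by (intro sum.cong) auto
    finally show ?thesis using n0(2)[OF that] by simp
  qed
  \<comment> \<open>The quotients cut down to the complement of \<open>L\<close>. The shift by
    \<open>n0\<close> makes the bound \<open>1 / r\<close> available at every index, as dominated
    convergence asks.\<close>
  define h where "h n x = (1 - indicator L x) * f (n + n0) x" for n x
  have [measurable]: "h n \<in> borel_measurable M" for n
    unfolding h_def by measurable
  have h_le: "AE x in M. norm (h n x) \<le> 1 / r" for n
    using f_le[of "n + n0", simplified]
  proof eventually_elim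
    case (elim x)
    then show ?case using f_nonneg r_pos by (auto simp: h_def indicator_def)
  qed
  have h_lim: "(\<lambda>n. h n x) \<longlonglongrightarrow> 0" for x
  proof (cases "x \<in> L")
    case True
    then show ?thesis by (simp add: h_def)
  next
    case False
    then obtain N where N: "\<And>k. N \<le> k \<Longrightarrow> x \<notin> A k"
      by (auto simp: L_def limsup_sets_def)
    \<comment> \<open>Only indices below \<open>N\<close> can count \<open>x\<close>, so the
      numerator stays bounded while the denominator diverges.\<close>
    have "(\<Sum>k=1..n. indicator (A k) x) \<le> real N" for n
    proof -
      have "(\<Sum>k=1..n. indicator (A k) x) \<le> (\<Sum>k=1..n. indicator {..<N} k :: real)"
        using N by (intro sum_mono) (auto simp: indicator_def not_less[symmetric])
      also have "\<dots> = real (card ({1..n} \<inter> {..<N}))"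
        by (simp add: indicator_def sum.If_cases Int_def)
      also have "\<dots> \<le> real N"
        using card_mono[of "{..<N}" "{1..n} \<inter> {..<N}"] by simp
      finally show ?thesis .
    qed
    then have le: "f (n + n0) x \<le> real N / E (n + n0)" for n
      unfolding f_def using n0(2)[of "n + n0"] by (intro divide_right_mono) auto
    have "(\<lambda>n. real N / E (n + n0)) \<longlonglongrightarrow> 0"
      by (rule LIMSEQ_ignore_initial_segment
          [OF real_tendsto_divide_at_top[OF tendsto_const E_lim]])
    then have "(\<lambda>n. f (n + n0) x) \<longlonglongrightarrow> 0"
      by (rule tendsto_sandwich
          [OF always_eventually[OF allI[OF f_nonneg]] always_eventually[OF allI[OF le]] tendsto_const])
    then show ?thesis using False by (simp add: h_def)
  qed
  have "(\<lambda>n. integral\<^sup>L M (h n)) \<longlonglongrightarrow> integral\<^sup>L M (\<lambda>x. 0)"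
    using h_lim h_le by (intro integral_dominated_convergence[where w = "\<lambda>_. 1 / r"]) auto
  then have "(\<lambda>n. prob L / r + integral\<^sup>L M (h n)) \<longlonglongrightarrow> prob L / r + 0"
    by (intro tendsto_intros) simp
  \<comment> \<open>The integral of the quotient, which is 1, is split at \<open>L\<close>: on
    \<open>L\<close> the quotient is at most \<open>1 / r\<close>, which contributes at most
    \<open>prob L / r\<close>; the rest is the integral of \<open>h n\<close>, which vanishes in the
    limit.\<close>
  moreover have "1 \<le> prob L / r + integral\<^sup>L M (h n)" for n
  proof -
    have h_int: "integrable M (h n)"
      using h_le by (intro integrable_const_bound) auto
    have L_int: "integrable M (\<lambda>x. indicator L x / r)"
      by (intro integrable_divide integrable_real_indicator) (auto simp: less_top[symmetric])
    have "integral\<^sup>L M (f (n + n0)) \<le> (\<integral>x. indicator L x / r + h n x \<partial>M)"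
    proof (rule integral_mono_AE)
      show "AE x in M. f (n + n0) x \<le> indicator L x / r + h n x"
        using f_le[of "n + n0", simplified]
        by eventually_elim (auto simp: h_def indicator_def)
    qed (use f_int h_int L_int in auto)
    also have "\<dots> = prob L / r + integral\<^sup>L M (h n)"
      using h_int L_int by (subst Bochner_Integration.integral_add) auto
    finally show ?thesis using integral_f[of "n + n0"] by simp
  qed
  ultimately have "1 \<le> prob L / r + 0"
    by (intro LIMSEQ_le_const) auto
  then show False using r r_pos by (simp add: field_simps)
qed

end

section \<open>Making finitely many intervals disjoint\<close>

text \<open>Suppose a point \<open>x\<close> of \<open>A\<close> lay between two points
  \<open>a\<close>, \<open>b\<close> of \<open>B - A\<close>. A point \<open>y\<close> of
  \<open>A\<close> outside \<open>B\<close> cannot lie between \<open>a\<close> and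
  \<open>b\<close>, so it is beyond one of them, and the part of \<open>A\<close> from
  \<open>y\<close> to \<open>x\<close> would contain that endpoint.\<close>

lemma is_interval_diff:
  fixes A B :: "real set"
  assumes "is_interval A" "is_interval B" "\<not> A \<subseteq> B"
  shows "is_interval (B - A)"
  unfolding is_interval_1
proof (intro ballI allI impI)
  fix a b x assume ab: "a \<in> B - A" "b \<in> B - A" and x: "a \<le> x \<and> x \<le> b"
  obtain y where y: "y \<in> A" "y \<notin> B" using assms(3) by auto
  have "x \<in> B" using assms(2) ab x unfolding is_interval_1 by blast
  moreover have "x \<notin> A"
  proof
    assume "x \<in> A"
    consider "y \<le> a" | "b \<le> y" | "a \<le> y" "y \<le> b" by linarith
    then show False
    proof cases
      case 1
      then show ?thesis using assms(1) y(1) \<open>x \<in> A\<close> ab x unfolding is_interval_1 by blast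
    next
      case 2
      then show ?thesis using assms(1) y(1) \<open>x \<in> A\<close> ab x unfolding is_interval_1 by blast
    next
      case 3
      then show ?thesis using assms(2) y(2) ab unfolding is_interval_1 by blast
    qed
  qed
  ultimately show "x \<in> B - A" by simp
qed

text \<open>
  A new interval is either inside one of the disjoint intervals constructed so far, and is then
  replaced by the empty set, or it is kept and removed from all the others, which remain intervals
  because none of them contains it.
\<close>

lemma disjoint_subintervals:
  fixes A :: "'i \<Rightarrow> real set"
  assumes "finite F" "\<And>i. i \<in> F \<Longrightarrow> is_interval (A i)"
  shows "\<exists>B. (\<forall>i\<in>F. is_interval (B i) \<and> B i \<subseteq> A i) \<and> disjoint_family_on B F \<and>
    (\<Union>i\<in>F. B i) = (\<Union>i\<in>F. A i)"
  using assms
proof (induction F)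
  case empty
  then show ?case by (auto simp: disjoint_family_on_def)
next
  case (insert j F)
  then obtain B where B: "\<forall>i\<in>F. is_interval (B i) \<and> B i \<subseteq> A i" "disjoint_family_on B F"
    "(\<Union>i\<in>F. B i) = (\<Union>i\<in>F. A i)" by auto
  show ?case
  proof (cases "\<exists>i\<in>F. A j \<subseteq> B i")
    case True
    have "\<forall>i\<in>insert j F. is_interval ((B(j := {})) i) \<and> (B(j := {})) i \<subseteq> A i"
      using B(1) by auto
    moreover have "disjoint_family_on (B(j := {})) (insert j F)"
      using B(2) by (auto simp: disjoint_family_on_def)
    moreover have "(\<Union>i\<in>insert j F. (B(j := {})) i) = (\<Union>i\<in>insert j F. A i)"
    proof -
      have "(\<Union>i\<in>insert j F. (B(j := {})) i) = (\<Union>i\<in>F. B i)"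
        using insert.hyps(2) by auto
      also have "\<dots> = (\<Union>i\<in>insert j F. A i)"
        using True unfolding UN_insert B(3)[symmetric] by auto
      finally show ?thesis .
    qed
    ultimately show ?thesis by blast
  next
    case False
    define C where "C i = (if i = j then A j else B i - A j)" for i
    have "\<forall>i\<in>insert j F. is_interval (C i) \<and> C i \<subseteq> A i"
      using False B(1) insert.prems is_interval_diff[of "A j"] by (auto simp: C_def)
    moreover have "disjoint_family_on C (insert j F)"
      using B(2) by (auto simp: disjoint_family_on_def C_def)
    moreover have "(\<Union>i\<in>insert j F. C i) = (\<Union>i\<in>insert j F. A i)"
    proof -
      have "(\<Union>i\<in>insert j F. C i) = A j \<union> (\<Union>i\<in>F. B i)"
        using insert.hyps(2) by (auto simp: C_def)
      then show ?thesis using B(3) by simp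
    qed
    ultimately show ?thesis by blast
  qed
qed

section \<open>Cutting the index set into finite blocks\<close>

text \<open>The tail union from \<open>N\<close> on contains the upper limit and is the increasing
  limit of finite unions, so continuity from below applies; the strict bound on \<open>c\<close>
  lets a finite stage reach it. Asking for \<open>m > N\<close> makes the block boundaries strictly
  increasing.\<close>

lemma (in prob_space) exists_block:
  assumes events: "\<And>k. k > 0 \<Longrightarrow> A k \<in> events"
    and "0 < N" "c < prob (limsup_sets A)"
  shows "\<exists>m>N. c \<le> prob (\<Union>k\<in>{N..<m}. A k)"
proof -
  define U where "U m = (\<Union>k\<in>{N..<m}. A k)" for m
  have "U m \<in> events" for m
    unfolding U_def using events \<open>0 < N\<close> by (intro sets.countable_UN') auto
  moreover have "incseq U"
    unfolding U_def by (intro monoI UN_mono) auto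
  ultimately have lim: "(\<lambda>m. prob (U m)) \<longlonglongrightarrow> prob (\<Union>m. U m)"
    by (intro finite_Lim_measure_incseq) auto
  have "limsup_sets A \<subseteq> (\<Union>k\<in>{N..}. A k)"
    unfolding limsup_sets_def using \<open>0 < N\<close> by auto
  also have "\<dots> \<subseteq> (\<Union>m. U m)"
    unfolding U_def by force
  finally have "prob (limsup_sets A) \<le> prob (\<Union>m. U m)"
    using \<open>\<And>m. U m \<in> events\<close> by (intro finite_measure_mono) auto
  then have "eventually (\<lambda>m. c < prob (U m)) sequentially"
    using lim assms(3) by (auto intro: order_tendstoD(1))
  then have "eventually (\<lambda>m. N < m \<and> c < prob (U m)) sequentially"
    using eventually_gt_at_top by (rule eventually_conj[rotated])
  then show ?thesis
    unfolding U_def by (auto simp: eventually_sequentially intro: less_imp_le)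
qed

text \<open>The blocks partition the indices from \<open>a 0\<close> on. Some right end exceeds
  \<open>k\<close> because \<open>a\<close> grows at least like the identity, and minimality puts
  \<open>k\<close> at or after the left end of that block. Membership in a block thus becomes an
  equation for the block number.\<close>

lemma block_index:
  fixes a :: "nat \<Rightarrow> nat"
  assumes "strict_mono a" "a 0 \<le> k"
  shows "a j \<le> k \<and> k < a (Suc j) \<longleftrightarrow> j = (LEAST j. k < a (Suc j))"
proof -
  define l where "l = (LEAST j. k < a (Suc j))"
  have "k < a (Suc k)"
    using strict_mono_imp_increasing[OF assms(1), of "Suc k"] by simp
  then have l: "k < a (Suc l)"
    unfolding l_def by (rule LeastI)
  have "a l \<le> k"
  proof (cases l)
    case 0
    then show ?thesis using assms by simp
  next
    case (Suc i)
    then have "\<not> k < a (Suc i)"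
      unfolding l_def by (intro not_less_Least) simp
    then show ?thesis using Suc by simp
  qed
  moreover have "j = l" if "a j \<le> k" "k < a (Suc j)"
  proof -
    have "a j < a (Suc l)" "a l < a (Suc j)"
      using that l \<open>a l \<le> k\<close> by auto
    then show ?thesis using assms(1) by (simp add: strict_mono_less)
  qed
  ultimately show ?thesis using l by (auto simp: l_def)
qed

lemma sum_blocks:
  fixes f :: "nat \<Rightarrow> 'a::comm_monoid_add"
  assumes "mono a"
  shows "(\<Sum>k\<in>{a 0..<a m}. f k) = (\<Sum>j<m. \<Sum>k\<in>{a j..<a (Suc j)}. f k)"
proof (induction m)
  case (Suc m)
  have "(\<Sum>k\<in>{a 0..<a (Suc m)}. f k) =
      (\<Sum>k\<in>{a 0..<a m}. f k) + (\<Sum>k\<in>{a m..<a (Suc m)}. f k)"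
    by (rule sum.atLeastLessThan_concat[symmetric]) (auto intro: monoD[OF assms])
  then show ?case using Suc by simp
qed simp

section \<open>Construction of the subintervals and estimate of the quotients\<close>

text \<open>Measurability is assumed for all subintervals of each \<open>I k\<close>, since the sets
  \<open>\<Gamma> k\<close> only arise during the construction.\<close>

lemma exists_balanced_subintervals:
  fixes I :: "nat \<Rightarrow> real set" and \<delta> :: real and M :: "real measure"
  assumes "prob_space M"
    and interval: "\<And>k. k > 0 \<Longrightarrow> is_interval (I k)"
    and sets: "\<And>k B. k > 0 \<Longrightarrow> is_interval B \<Longrightarrow> B \<subseteq> I k \<Longrightarrow> B \<in> sets M"
    and \<delta>: "0 < \<delta>" "\<delta> \<le> measure M (limsup_sets I)"
  shows "\<exists>\<Gamma>. (\<forall>k>0. is_interval (\<Gamma> k) \<and> \<Gamma> k \<subseteq> I k) \<and>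
    filterlim (\<lambda>n. \<Sum>k=1..n. measure M (\<Gamma> k)) at_top sequentially \<and>
    limsup (\<lambda>n. Linf_norm M
      (\<lambda>x. (\<Sum>k=1..n. indicator (\<Gamma> k) x) / (\<Sum>k=1..n. measure M (\<Gamma> k)))) \<le> ereal (1 / \<delta>)"
proof -
  interpret prob_space M by fact
  have I_sets: "I k \<in> sets M" if "k > 0" for k
    using that interval sets by blast
  \<comment> \<open>Block boundaries are chosen recursively, starting at 1 because index 0 is
    ignored. The slack \<open>(1/2)^j\<close> makes the target strictly smaller than the measure of
    the upper limit, and it is summable, so the total loss stays below 2.\<close>
  have "\<exists>a. \<forall>j. (0 < a j \<and> (j = 0 \<longrightarrow> a j = 1)) \<and>
      (a j < a (Suc j) \<and> \<delta> - (1/2)^j \<le> prob (\<Union>k\<in>{a j..<a (Suc j)}. I k))"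
  proof (rule dependent_nat_choice)
    fix N j :: nat
    assume "0 < N \<and> (j = 0 \<longrightarrow> N = 1)"
    moreover have "\<delta> - (1/2)^j < prob (limsup_sets I)"
      using \<delta>(2) zero_less_power[of "1/2::real" j] by linarith
    ultimately have "\<exists>m>N. \<delta> - (1/2)^j \<le> prob (\<Union>k\<in>{N..<m}. I k)"
      using I_sets by (intro exists_block) auto
    then obtain m where "N < m" "\<delta> - (1/2)^j \<le> prob (\<Union>k\<in>{N..<m}. I k)"
      by blast
    then show "\<exists>m. (0 < m \<and> (Suc j = 0 \<longrightarrow> m = 1)) \<and>
        (N < m \<and> \<delta> - (1/2)^j \<le> prob (\<Union>k\<in>{N..<m}. I k))"
      by (intro exI[of _ m]) simp
  qed auto
  then obtain a :: "nat \<Rightarrow> nat" where a_pos: "\<And>j. 0 < a j" and a0: "a 0 = 1"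
    and a_less: "\<And>j. a j < a (Suc j)"
    and a_prob: "\<And>j. \<delta> - (1/2)^j \<le> prob (\<Union>k\<in>{a j..<a (Suc j)}. I k)"
    by blast
  have a_mono: "strict_mono a"
    using a_less by (simp add: strict_mono_Suc_iff)
  have "\<exists>B. (\<forall>k\<in>{a j..<a (Suc j)}. is_interval (B k) \<and> B k \<subseteq> I k) \<and>
      disjoint_family_on B {a j..<a (Suc j)} \<and>
      (\<Union>k\<in>{a j..<a (Suc j)}. B k) = (\<Union>k\<in>{a j..<a (Suc j)}. I k)" for j
    using interval a_pos[of j] by (intro disjoint_subintervals) auto
  then have "\<exists>B. \<forall>j. (\<forall>k\<in>{a j..<a (Suc j)}. is_interval (B j k) \<and> B j k \<subseteq> I k) \<and>
      disjoint_family_on (B j) {a j..<a (Suc j)} \<and>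
      (\<Union>k\<in>{a j..<a (Suc j)}. B j k) = (\<Union>k\<in>{a j..<a (Suc j)}. I k)"
    by (intro choice allI)
  then obtain B where B_all: "\<forall>j. (\<forall>k\<in>{a j..<a (Suc j)}. is_interval (B j k) \<and> B j k \<subseteq> I k) \<and>
      disjoint_family_on (B j) {a j..<a (Suc j)} \<and>
      (\<Union>k\<in>{a j..<a (Suc j)}. B j k) = (\<Union>k\<in>{a j..<a (Suc j)}. I k)"
    by (rule exE)
  have B: "is_interval (B j k) \<and> B j k \<subseteq> I k" if "k \<in> {a j..<a (Suc j)}" for j k
    using spec[OF B_all, of j] that by (elim conjE) (rule bspec)
  have B_disj: "disjoint_family_on (B j) {a j..<a (Suc j)}" for j
    using spec[OF B_all, of j] by (elim conjE)
  have B_Un: "(\<Union>k\<in>{a j..<a (Suc j)}. B j k) = (\<Union>k\<in>{a j..<a (Suc j)}. I k)" for j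
    using spec[OF B_all, of j] by (elim conjE)
  define l where "l k = (LEAST j. k < a (Suc j))" for k
  have l_iff: "a j \<le> k \<and> k < a (Suc j) \<longleftrightarrow> j = l k" if "0 < k" for j k
    unfolding l_def using block_index[OF a_mono, of k j] that by (simp add: a0)
  \<comment> \<open>Each block has its own disjoint family; index \<open>k\<close> takes its set
    from the family of the block \<open>l k\<close> that contains it.\<close>
  define \<Gamma> where "\<Gamma> k = B (l k) k" for k
  have \<Gamma>: "is_interval (\<Gamma> k) \<and> \<Gamma> k \<subseteq> I k" if "0 < k" for k
    using B[of k "l k"] l_iff[OF that, of "l k"] by (simp add: \<Gamma>_def)
  have \<Gamma>_sets: "\<Gamma> k \<in> sets M" if "0 < k" for k
    using \<Gamma>[OF that] sets[OF that] by blast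
  have \<Gamma>_B: "\<Gamma> k = B j k" if "k \<in> {a j..<a (Suc j)}" for j k
    using l_iff[of k j] that a_pos[of j] by (auto simp: \<Gamma>_def)
  have \<Gamma>_disj: "disjoint_family_on \<Gamma> {a j..<a (Suc j)}" for j
    using B_disj[of j] unfolding disjoint_family_on_def by (simp add: \<Gamma>_B[of _ j])
  define S :: "nat \<Rightarrow> real \<Rightarrow> real" where "S n x = (\<Sum>k=1..n. indicator (\<Gamma> k) x)" for n x
  define E where "E n = (\<Sum>k=1..n. prob (\<Gamma> k))" for n
  have block_S: "(\<Sum>k\<in>{a j..<a (Suc j)}. indicator (\<Gamma> k) x) \<le> (1::real)" for j x
  proof -
    have "(\<Sum>k\<in>{a j..<a (Suc j)}. indicator (\<Gamma> k) x) =
        (indicator (\<Union>k\<in>{a j..<a (Suc j)}. \<Gamma> k) x :: real)"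
      using \<Gamma>_disj by (intro indicator_UN_disjoint[symmetric]) auto
    then show ?thesis by simp
  qed
  have block_E: "\<delta> - (1/2)^j \<le> (\<Sum>k\<in>{a j..<a (Suc j)}. prob (\<Gamma> k))" for j
  proof -
    have "(\<Union>k\<in>{a j..<a (Suc j)}. \<Gamma> k) = (\<Union>k\<in>{a j..<a (Suc j)}. I k)"
      unfolding B_Un[of j, symmetric] by (intro SUP_cong refl \<Gamma>_B)
    moreover have "prob (\<Union>k\<in>{a j..<a (Suc j)}. \<Gamma> k) = (\<Sum>k\<in>{a j..<a (Suc j)}. prob (\<Gamma> k))"
      using \<Gamma>_disj[of j] \<Gamma>_sets a_pos[of j] by (intro finite_measure_finite_Union) auto
    ultimately show ?thesis using a_prob[of j] by simp
  qed
  \<comment> \<open>The block containing \<open>n\<close> is counted in full, which gives the blocks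
    \<open>0\<close> to \<open>l n\<close>.\<close>
  have S_le: "S n x \<le> real (l n) + 1" if "0 < n" for n x
  proof -
    have "S n x \<le> (\<Sum>k\<in>{a 0..<a (Suc (l n))}. indicator (\<Gamma> k) x)"
      unfolding S_def using l_iff[OF that, of "l n"] by (intro sum_mono2) (auto simp: a0)
    also have "\<dots> \<le> (\<Sum>j<Suc (l n). 1)"
      unfolding sum_blocks[OF strict_mono_mono[OF a_mono]] by (intro sum_mono block_S)
    finally show ?thesis by simp
  qed
  \<comment> \<open>Here only the \<open>l n\<close> blocks completed before \<open>n\<close> are
    counted. The mismatch of one block with the upper bound for \<open>S\<close> disappears in the
    limit.\<close>
  have E_ge: "\<delta> * real (l n) - 2 \<le> E n" if "0 < n" for n
  proof -
    have "(\<Sum>j<m. \<delta> - (1/2)^j) = \<delta> * real m - 2 + 2 * (1/2)^m" for m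
      by (induction m) (auto simp: algebra_simps)
    then have "\<delta> * real (l n) - 2 \<le> (\<Sum>j<l n. \<delta> - (1/2)^j)"
      by simp
    also have "\<dots> \<le> (\<Sum>k\<in>{a 0..<a (l n)}. prob (\<Gamma> k))"
      unfolding sum_blocks[OF strict_mono_mono[OF a_mono]] by (intro sum_mono block_E)
    also have "\<dots> \<le> E n"
      unfolding E_def using l_iff[OF that, of "l n"] by (intro sum_mono2) (auto simp: a0)
    finally show ?thesis .
  qed
  \<comment> \<open>Blocks are finite, so the block number tends to infinity and limits in the block
    number carry over to limits in \<open>n\<close>.\<close>
  have l_lim: "filterlim l at_top sequentially"
    unfolding filterlim_at_top
  proof
    fix j
    have "j \<le> l n" if "a j \<le> n" for n
    proof -
      have "0 < n" using that a_pos[of j] by simp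
      then have "a j < a (Suc (l n))"
        using that l_iff[of n "l n"] by simp
      then show ?thesis using a_mono by (simp add: strict_mono_less)
    qed
    then show "eventually (\<lambda>n. j \<le> l n) sequentially"
      unfolding eventually_sequentially by blast
  qed
  have lin: "filterlim (\<lambda>m. \<delta> * real m - 2) at_top sequentially"
    using \<delta>(1) by real_asymp
  have lin_l: "filterlim (\<lambda>n. \<delta> * real (l n) - 2) at_top sequentially"
    by (rule filterlim_compose[OF lin l_lim])
  have E_lim: "filterlim E at_top sequentially"
    by (rule filterlim_at_top_mono[OF lin_l eventually_mono[OF eventually_gt_at_top[of 0] E_ge]])
  have "(\<lambda>m. (real m + 1) / (\<delta> * real m - 2)) \<longlonglongrightarrow> inverse \<delta>"
    using \<delta>(1) by real_asymp
  then have "(\<lambda>m. (real m + 1) / (\<delta> * real m - 2)) \<longlonglongrightarrow> 1 / \<delta>"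
    by (simp add: inverse_eq_divide)
  then have ratio: "(\<lambda>n. (real (l n) + 1) / (\<delta> * real (l n) - 2)) \<longlonglongrightarrow> 1 / \<delta>"
    by (rule filterlim_compose[OF _ l_lim])
  \<comment> \<open>The lower bound for \<open>E n\<close> may replace it in the denominator only
    once it is positive.\<close>
  have "eventually (\<lambda>n. 0 < \<delta> * real (l n) - 2) sequentially"
    using lin_l unfolding filterlim_at_top_dense by (rule spec)
  then have "eventually (\<lambda>n. Linf_norm M (\<lambda>x. S n x / E n) \<le>
      ereal ((real (l n) + 1) / (\<delta> * real (l n) - 2))) sequentially"
    using eventually_gt_at_top[of 0]
  proof eventually_elim
    case (elim n)
    have "\<bar>S n x / E n\<bar> \<le> (real (l n) + 1) / (\<delta> * real (l n) - 2)" for x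
    proof -
      have "0 \<le> S n x" by (simp add: S_def sum_nonneg)
      moreover have "S n x / E n \<le> (real (l n) + 1) / (\<delta> * real (l n) - 2)"
        using elim S_le E_ge by (intro frac_le) auto
      moreover have "0 < E n" using elim E_ge[of n] by linarith
      ultimately show ?thesis by simp
    qed
    moreover have [measurable]: "(\<lambda>x. S n x / E n) \<in> borel_measurable M"
      unfolding S_def using \<Gamma>_sets
      by (intro borel_measurable_divide borel_measurable_sum borel_measurable_indicator) auto
    moreover have "(\<lambda>x. ereal \<bar>S n x / E n\<bar>) \<in> borel_measurable M"
      by measurable
    ultimately show ?case
      unfolding Linf_norm_def by (intro esssup_I AE_I2) (simp_all del: abs_divide)
  qed
  then have "limsup (\<lambda>n. Linf_norm M (\<lambda>x. S n x / E n)) \<le>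
      limsup (\<lambda>n. ereal ((real (l n) + 1) / (\<delta> * real (l n) - 2)))"
    by (rule Limsup_mono)
  also have "\<dots> = ereal (1 / \<delta>)"
    using ratio by (intro lim_imp_Limsup) auto
  finally show ?thesis
    using \<Gamma> E_lim unfolding S_def E_def by blast
qed

section \<open>Equivalence of large upper limit and balanced subintervals\<close>

theorem proposition2p2:
  fixes J :: "real set" and \<mu> :: "real measure"
    and I :: "nat \<Rightarrow> real set" and \<delta> :: real
  assumes "is_interval J"
    and "prob_space \<mu>"
    and "sets \<mu> = sets (restrict_space borel J)"
    and "\<And>k. k > 0 \<Longrightarrow> is_interval (I k)"
    and "\<And>k. k > 0 \<Longrightarrow> I k \<subseteq> J"
    and "\<delta> \<in> {0<..1}"
  shows "measure \<mu> (limsup_sets I) \<ge> \<delta> \<longleftrightarrow>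
    (\<exists>\<Gamma> :: nat \<Rightarrow> real set.
       (\<forall>k>0. is_interval (\<Gamma> k) \<and> \<Gamma> k \<subseteq> I k) \<and>
       (\<Sum>k. emeasure \<mu> (\<Gamma> (Suc k))) = \<infinity> \<and>
       limsup (\<lambda>n. Linf_norm \<mu>
         (\<lambda>x. (\<Sum>k=1..n. indicator (\<Gamma> k) x) / (\<Sum>k=1..n. measure \<mu> (\<Gamma> k))))
       \<le> ereal (1 / \<delta>))"
proof -
  interpret prob_space \<mu> by fact
  \<comment> \<open>Intervals are Borel, and one contained in \<open>J\<close> belongs to the trace
    of the Borel sets on \<open>J\<close>.\<close>
  have sets: "B \<in> sets \<mu>" if "0 < k" "is_interval B" "B \<subseteq> I k" for k B
  proof -
    have "J \<in> sets borel" "B \<in> sets borel"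
      using assms(1) that(2) by (auto intro: real_interval_borel_measurable)
    then show ?thesis
      using assms(3) assms(5)[OF that(1)] that(3) by (auto simp: sets_restrict_space_iff)
  qed
  have sum_iff: "(\<Sum>k. emeasure \<mu> (\<Gamma> (Suc k))) = \<infinity> \<longleftrightarrow>
      filterlim (\<lambda>n. \<Sum>k=1..n. measure \<mu> (\<Gamma> k)) at_top sequentially" for \<Gamma>
    unfolding emeasure_eq_measure
    by (rule partial_sums_at_top_iff[symmetric, of "\<lambda>k. measure \<mu> (\<Gamma> k)", OF measure_nonneg])
  show ?thesis
    unfolding sum_iff
  proof
    assume \<delta>: "\<delta> \<le> measure \<mu> (limsup_sets I)"
    show "\<exists>\<Gamma>. (\<forall>k>0. is_interval (\<Gamma> k) \<and> \<Gamma> k \<subseteq> I k) \<and>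
        filterlim (\<lambda>n. \<Sum>k=1..n. measure \<mu> (\<Gamma> k)) at_top sequentially \<and>
        limsup (\<lambda>n. Linf_norm \<mu>
          (\<lambda>x. (\<Sum>k=1..n. indicator (\<Gamma> k) x) / (\<Sum>k=1..n. measure \<mu> (\<Gamma> k)))) \<le> ereal (1 / \<delta>)"
      by (rule exists_balanced_subintervals[OF assms(2,4) sets _ \<delta>]) (use assms(6) in auto)
  next
    assume "\<exists>\<Gamma>. (\<forall>k>0. is_interval (\<Gamma> k) \<and> \<Gamma> k \<subseteq> I k) \<and>
        filterlim (\<lambda>n. \<Sum>k=1..n. measure \<mu> (\<Gamma> k)) at_top sequentially \<and>
        limsup (\<lambda>n. Linf_norm \<mu>
          (\<lambda>x. (\<Sum>k=1..n. indicator (\<Gamma> k) x) / (\<Sum>k=1..n. measure \<mu> (\<Gamma> k)))) \<le> ereal (1 / \<delta>)"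
    then obtain \<Gamma> where \<Gamma>: "\<forall>k>0. is_interval (\<Gamma> k) \<and> \<Gamma> k \<subseteq> I k"
      "filterlim (\<lambda>n. \<Sum>k=1..n. measure \<mu> (\<Gamma> k)) at_top sequentially"
      "limsup (\<lambda>n. Linf_norm \<mu>
          (\<lambda>x. (\<Sum>k=1..n. indicator (\<Gamma> k) x) / (\<Sum>k=1..n. measure \<mu> (\<Gamma> k)))) \<le> ereal (1 / \<delta>)"
      by (elim exE conjE)
    have \<Gamma>_sets: "\<Gamma> k \<in> events" if "0 < k" for k
      using \<Gamma>(1) sets[of k] that by blast
    have "\<delta> \<le> prob (limsup_sets \<Gamma>)"
      using assms(6) by (intro measure_limsup_sets_ge[OF \<Gamma>_sets _ \<Gamma>(2,3)]) auto
    also have "\<dots> \<le> prob (limsup_sets I)"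
      using \<Gamma>(1) sets[OF _ assms(4)]
      by (intro finite_measure_mono limsup_sets_mono sets_limsup_sets) auto
    finally show "\<delta> \<le> prob (limsup_sets I)" .
  qed
qed

end
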